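(* Let $\varepsilon,p$ be two real numbers such that $0<\varepsilon<2d$ and $p\ge1$. Then there is a nonnegative constant $N_{\varepsilon,p}$ such that for every quaternion window function $g$, every $f\in L^2(\mathbb{R}^{2d},\mathbb{H})$ and every measurable subset $\Sigma$ of $\mathbb{R}^{2d}\times\mathbb{R}^{2d}$ of finite measure, $$\|\chi_\Sigma W(f,g)\|_{p,4d}^{p(p+1)}\le N_{\varepsilon,p}\;\mu_{4d}(\Sigma)\;\big\||(x,w)|^\varepsilon W(f,g)\big\|_{2,4d}^{\frac{4pd}{2d+\varepsilon}}\big(\|f\|_{2,2d}\|g\|_{2,2d}\big)^{p\left(p-\frac{2d-\varepsilon}{2d+\varepsilon}\right)},$$ where $$N_{\varepsilon,p}=2^{2d(p-2)(p+1)+4d+\frac{4pd\varepsilon}{2d+\varepsilon}}\left(\frac{2d+\varepsilon}{2^{\frac{\varepsilon(2d+2p+2)}{(2d+\varepsilon)(p+1)}}\,\varepsilon^{\frac{2\varepsilon}{2d+\varepsilon}}\,\Gamma(2d)^{\frac{\varepsilon}{(2d+\varepsilon)(p+1)}}\,(2d-\varepsilon)^{\frac{2d-\varepsilon}{2d+\varepsilon}+\frac{\varepsilon}{(2d+\varepsilon)(p+1)}}}\right)^{p(p+1)}.$$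
   Context: $d\ge 1$ is an integer and $\mathbb{H}$ is the algebra of quaternions with units $i,j,k$. On $\mathbb{R}^n$, $d\mu_n(x)=dx/(2\pi)^{n/2}$, $\|F\|_{p,n}=\big(\int_{\mathbb{R}^n}|F|^pd\mu_n\big)^{1/p}\in[0,\infty]$, and $\mathbb{R}^{2d}\times\mathbb{R}^{2d}$ is identified with $\mathbb{R}^{4d}$; $|(x,w)|$ is the Euclidean norm on $\mathbb{R}^{4d}$ and $\chi_\Sigma$ the indicator function of $\Sigma$. A quaternion window function is a non-zero $g\in L^2(\mathbb{R}^{2d},\mathbb{H})$. The quaternion Wigner transform is $$W(f,g)(x,w)=\int_{\mathbb{R}^{2d}}e^{-i\,w_1\cdot t_1}f\big(x+\tfrac t2\big)\overline{g\big(x-\tfrac t2\big)}e^{-j\,w_2\cdot t_2}\,d\mu_{2d}(t),\quad x\in\mathbb{R}^{2d},\ w=(w_1,w_2),\ t=(t_1,t_2)\in\mathbb{R}^d\times\mathbb{R}^d.$$ Convention: $0\cdot\infty=0$. *)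

theory Defs
  imports "HOL-Analysis.Analysis"
begin

section \<open>Quaternions\<close>

codatatype quat = Quat (qRe: real) (qI: real) (qJ: real) (qK: real)

lemma quat_eqI [intro?]:
  "\<lbrakk>qRe x = qRe y; qI x = qI y; qJ x = qJ y; qK x = qK y\<rbrakk> \<Longrightarrow> x = y"
  by (rule quat.expand) simp

lemma quat_eq_iff: "x = y \<longleftrightarrow> qRe x = qRe y \<and> qI x = qI y \<and> qJ x = qJ y \<and> qK x = qK y"
  by (auto intro: quat_eqI)

instantiation quat :: ab_group_add
begin

primcorec zero_quat where
  "qRe 0 = 0" | "qI 0 = 0" | "qJ 0 = 0" | "qK 0 = 0"

primcorec plus_quat where
  "qRe (x + y) = qRe x + qRe y"
| "qI (x + y) = qI x + qI y"
| "qJ (x + y) = qJ x + qJ y"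
| "qK (x + y) = qK x + qK y"

primcorec uminus_quat where
  "qRe (- x) = - qRe x"
| "qI (- x) = - qI x"
| "qJ (- x) = - qJ x"
| "qK (- x) = - qK x"

primcorec minus_quat where
  "qRe (x - y) = qRe x - qRe y"
| "qI (x - y) = qI x - qI y"
| "qJ (x - y) = qJ x - qJ y"
| "qK (x - y) = qK x - qK y"

instance
  by standard (simp_all add: quat_eq_iff)

end

primcorec qcnj :: "quat \<Rightarrow> quat" where
  "qRe (qcnj x) = qRe x"
| "qI (qcnj x) = - qI x"
| "qJ (qcnj x) = - qJ x"
| "qK (qcnj x) = - qK x"

text \<open>Hamilton's product, determined by $i^2 = j^2 = k^2 = ijk = -1$
  (see \<open>quat_unit_mult\<close> below).\<close>

instantiation quat :: real_algebra_1
begin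

primcorec one_quat where
  "qRe 1 = 1" | "qI 1 = 0" | "qJ 1 = 0" | "qK 1 = 0"

primcorec times_quat where
  "qRe (x * y) = qRe x * qRe y - qI x * qI y - qJ x * qJ y - qK x * qK y"
| "qI (x * y) = qRe x * qI y + qI x * qRe y + qJ x * qK y - qK x * qJ y"
| "qJ (x * y) = qRe x * qJ y - qI x * qK y + qJ x * qRe y + qK x * qI y"
| "qK (x * y) = qRe x * qK y + qI x * qJ y - qJ x * qI y + qK x * qRe y"

primcorec scaleR_quat where
  "qRe (r *\<^sub>R x) = r * qRe x"
| "qI (r *\<^sub>R x) = r * qI x"
| "qJ (r *\<^sub>R x) = r * qJ x"
| "qK (r *\<^sub>R x) = r * qK x"

instance
  by standard (simp_all add: quat_eq_iff algebra_simps)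

end

instantiation quat :: real_inner
begin

definition inner_quat :: "quat \<Rightarrow> quat \<Rightarrow> real" where
  "inner_quat x y = qRe x * qRe y + qI x * qI y + qJ x * qJ y + qK x * qK y"

definition norm_quat :: "quat \<Rightarrow> real" where
  "norm_quat x = sqrt ((qRe x)\<^sup>2 + (qI x)\<^sup>2 + (qJ x)\<^sup>2 + (qK x)\<^sup>2)"

definition sgn_quat :: "quat \<Rightarrow> quat" where
  "sgn_quat x = x /\<^sub>R norm x"

definition dist_quat :: "quat \<Rightarrow> quat \<Rightarrow> real" where
  "dist_quat x y = norm (x - y)"

definition uniformity_quat :: "(quat \<times> quat) filter" where
  [code del]: "uniformity_quat = (INF e\<in>{0 <..}. principal {(x, y). dist x y < e})"

definition open_quat :: "quat set \<Rightarrow> bool" where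
  [code del]: "open_quat U \<longleftrightarrow> (\<forall>x\<in>U. eventually (\<lambda>(x', y). x' = x \<longrightarrow> y \<in> U) uniformity)"

instance
proof
  fix x y z :: quat and r :: real
  show "inner x y = inner y x"
    by (simp add: inner_quat_def mult.commute)
  show "inner (x + y) z = inner x z + inner y z" and "inner (r *\<^sub>R x) y = r * inner x y"
    by (simp_all add: inner_quat_def algebra_simps)
  show "0 \<le> inner x x"
    by (simp add: inner_quat_def)
  show "inner x x = 0 \<longleftrightarrow> x = 0"
    by (simp add: inner_quat_def quat_eq_iff power2_eq_square [symmetric] add_nonneg_eq_0_iff)
  show "norm x = sqrt (inner x x)"
    by (simp add: inner_quat_def norm_quat_def power2_eq_square)
qed (rule sgn_quat_def dist_quat_def uniformity_quat_def open_quat_def)+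

end

instantiation quat :: real_normed_div_algebra
begin

definition inverse_quat :: "quat \<Rightarrow> quat" where
  "inverse_quat x = qcnj x /\<^sub>R (norm x)\<^sup>2"

definition divide_quat :: "quat \<Rightarrow> quat \<Rightarrow> quat" where
  "divide_quat x y = x * inverse y"

instance
proof
  fix x y :: quat
  have cnj: "qcnj x * x = (norm x)\<^sup>2 *\<^sub>R 1" "x * qcnj x = (norm x)\<^sup>2 *\<^sub>R 1"
    by (simp_all add: quat_eq_iff norm_quat_def power2_eq_square)
  show "x \<noteq> 0 \<Longrightarrow> inverse x * x = 1" and "x \<noteq> 0 \<Longrightarrow> x * inverse x = 1"
    by (simp_all add: inverse_quat_def cnj)
  show "inverse (0::quat) = 0"
    by (simp add: inverse_quat_def)
  show "x div y = x * inverse y"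
    by (simp add: divide_quat_def)
  show "norm (x * y) = norm x * norm y"
    unfolding norm_quat_def real_sqrt_mult [symmetric] times_quat.sel
    by (rule arg_cong [where f = sqrt]) algebra
qed

end

definition quat_i :: quat where "quat_i = Quat 0 1 0 0"
definition quat_j :: quat where "quat_j = Quat 0 0 1 0"
definition quat_k :: quat where "quat_k = Quat 0 0 0 1"

lemma quat_unit_mult:
  "quat_i * quat_i = -1" "quat_j * quat_j = -1" "quat_k * quat_k = -1"
  "quat_i * quat_j = quat_k" "quat_j * quat_k = quat_i" "quat_k * quat_i = quat_j"
  "quat_j * quat_i = - quat_k" "quat_k * quat_j = - quat_i" "quat_i * quat_k = - quat_j"
  by (simp_all add: quat_eq_iff quat_i_def quat_j_def quat_k_def)

text \<open>This instance provides the Bochner integral, the Borel structure and, through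
  \<^class>\<open>banach\<close>, the library's exponential series on quaternions.\<close>

instantiation quat :: euclidean_space
begin

definition Basis_quat :: "quat set" where
  "Basis_quat = {1, quat_i, quat_j, quat_k}"

instance
proof
  fix x u v :: quat
  show "Basis \<noteq> ({} :: quat set)" and "finite (Basis :: quat set)"
    by (simp_all add: Basis_quat_def)
  show "inner u v = (if u = v then 1 else 0)" if "u \<in> Basis" "v \<in> Basis"
    using that unfolding Basis_quat_def insert_iff empty_iff
    by (elim disjE) (simp_all add: inner_quat_def quat_i_def quat_j_def quat_k_def quat_eq_iff)
  show "(\<forall>u\<in>Basis. inner x u = 0) \<longleftrightarrow> x = 0"
    unfolding Basis_quat_def ball_simps
    by (simp add: inner_quat_def quat_i_def quat_j_def quat_k_def quat_eq_iff)
qed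

end


section \<open>Normalised Lebesgue measure and $L^p$ norms\<close>

definition mu :: "'a::euclidean_space measure" where
  "mu = density lebesgue (\<lambda>_. ennreal (1 / (2 * pi) powr (real DIM('a) / 2)))"

text \<open>Powers of extended nonnegative reals; only meant for positive exponents \<open>a\<close>.\<close>

definition enn_powr :: "ennreal \<Rightarrow> real \<Rightarrow> ennreal"  (infixr "powr\<^sub>e" 80) where
  "x powr\<^sub>e a = (if x = \<infinity> then \<infinity> else ennreal (enn2real x powr a))"

definition Lp_norm :: "real \<Rightarrow> ('a::euclidean_space \<Rightarrow> 'b::real_normed_vector) \<Rightarrow> ennreal" where
  "Lp_norm p F = (\<integral>\<^sup>+ x. ennreal (norm (F x) powr p) \<partial>mu) powr\<^sub>e (1 / p)"

definition L2 :: "('a::euclidean_space \<Rightarrow> quat) set" where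
  "L2 = {f. f \<in> borel_measurable lebesgue \<and> Lp_norm 2 f < \<infinity>}"

text \<open>Elements of $L^2$ are represented by functions, so being non-zero means not vanishing
  almost everywhere.\<close>

definition quat_window :: "('a::euclidean_space \<Rightarrow> quat) \<Rightarrow> bool" where
  "quat_window g \<longleftrightarrow> g \<in> L2 \<and> \<not> (AE x in lebesgue. g x = 0)"


section \<open>The quaternion Wigner transform\<close>

text \<open>With $d$ the cardinality of the index type, $\mathbf R^{2d}$ is the product of two copies
  of $\mathbf R^d$, and $\mathbf R^{4d}$ that of two copies of $\mathbf R^{2d}$; the library's
  norm on products is the Euclidean one.\<close>

type_synonym 'd R2d = "(real ^ 'd) \<times> (real ^ 'd)"

definition wigner :: "('d::finite R2d \<Rightarrow> quat) \<Rightarrow> ('d R2d \<Rightarrow> quat) \<Rightarrow> 'd R2d \<times> 'd R2d \<Rightarrow> quat" where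
  "wigner f g = (\<lambda>(x, w).
     \<integral>t. exp (- ((fst w \<bullet> fst t) *\<^sub>R quat_i)) * f (x + t /\<^sub>R 2) * qcnj (g (x - t /\<^sub>R 2))
         * exp (- ((snd w \<bullet> snd t) *\<^sub>R quat_j)) \<partial>mu)"

end

theory Submission
  imports Defs
begin

text \<open>By the Cauchy-Schwarz inequality \<open>W(f, g)\<close> is bounded by
  $L = 2^{2d} \|f\|_2 \|g\|_2$. Put $q = p / (p + 1)$ and let \<open>B\<close> be the ball of radius \<open>r\<close> around
  the origin. On $\Sigma \cap B$ one has $|W|^p \le L^{p - q} |W|^q$, on $\Sigma \setminus B$ one has
  $|W|^p \le L^{p - 2q} (|W|^2)^q$, and by Jensen's inequality the integrals of the concave \<open>q\<close>-th
  powers over \<open>\<Sigma>\<close> are at most $\mu(\Sigma)^{1 - q}$ times the \<open>q\<close>-th powers of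
  $\int_B |W|$ and $\int_{B^c} |W|^2$. With $M = \|\,|z|^\varepsilon W\|_2$, the first of
  these is at most $M (\int_B |z|^{-2\varepsilon})^{1/2}$, which is finite as $\varepsilon < 2d$, and the second
  at most $r^{-2\varepsilon} M^2$. Optimising over \<open>r\<close> gives exactly the constant \<open>N\<close>.\<close>

section \<open>Lebesgue integration\<close>

lemma AE_lborel_affine:
  fixes t :: "'a::euclidean_space"
  assumes "c \<noteq> 0" and "AE x in lborel. P x"
  shows "AE x in lborel. P (t + c *\<^sub>R x)"
proof -
  obtain N where N: "N \<in> null_sets lborel" "{x. \<not> P x} \<subseteq> N"
    using assms(2) by (auto simp: eventually_ae_filter)
  have "AE x in density (distr lborel borel (\<lambda>x. t + c *\<^sub>R x)) (\<lambda>_. \<bar>c\<bar>^DIM('a)). x \<notin> N"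
    using AE_not_in[OF N(1)] by (simp only: lborel_affine[OF assms(1), of t, symmetric])
  moreover have "{x. x \<notin> N} \<in> sets borel"
    using N(1) by (auto simp: null_sets_def Compl_eq[symmetric])
  ultimately have "AE x in lborel. t + c *\<^sub>R x \<notin> N"
    using assms(1) by (simp add: AE_density AE_distr_iff)
  then show ?thesis
    using N(2) by auto
qed

lemma nn_integral_lborel_affine:
  fixes f :: "'a::euclidean_space \<Rightarrow> ennreal"
  assumes "c \<noteq> 0" and [measurable]: "f \<in> borel_measurable borel"
  shows "(\<integral>\<^sup>+ x. f x \<partial>lborel) = ennreal (\<bar>c\<bar> ^ DIM('a)) * (\<integral>\<^sup>+ x. f (t + c *\<^sub>R x) \<partial>lborel)"
  by (subst lborel_affine[OF assms(1), of t])
     (simp add: nn_integral_density nn_integral_distr nn_integral_cmult)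

text \<open>Each coordinate has a Borel version off a null set, and there are finitely many
  coordinates. This makes the Wigner kernel jointly measurable in its two variables once
  \<open>f\<close> and \<open>g\<close> are replaced by Borel representatives.\<close>

lemma lebesgue_borel_version:
  fixes f :: "'a::euclidean_space \<Rightarrow> 'b::euclidean_space"
  assumes [measurable]: "f \<in> borel_measurable lebesgue"
  obtains f' where "f' \<in> borel_measurable borel" "AE x in lborel. f x = f' x"
proof -
  have "\<forall>b. \<exists>h \<in> borel_measurable lborel. AE x in lborel. f x \<bullet> b = h x"
    by (intro allI completion_ex_borel_measurable_real) measurable
  then obtain h where h: "\<And>b. h b \<in> borel_measurable lborel" "\<And>b. AE x in lborel. f x \<bullet> b = h b x"
    by metis
  have "AE x in lborel. \<forall>b\<in>Basis. f x \<bullet> b = h b x"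
    using h(2) by (simp add: AE_finite_all)
  then have "AE x in lborel. f x = (\<Sum>b\<in>Basis. h b x *\<^sub>R b)"
  proof eventually_elim
    case (elim x)
    have "f x = (\<Sum>b\<in>Basis. (f x \<bullet> b) *\<^sub>R b)"
      by (simp add: euclidean_representation)
    also have "\<dots> = (\<Sum>b\<in>Basis. h b x *\<^sub>R b)"
      using elim by (intro sum.cong) auto
    finally show ?case .
  qed
  moreover have "(\<lambda>x. \<Sum>b\<in>Basis. h b x *\<^sub>R b) \<in> borel_measurable borel"
    using h(1) by (intro borel_measurable_sum borel_measurable_scaleR) auto
  ultimately show ?thesis
    using that by blast
qed

lemma lebesgue_measurable_affine:
  fixes f :: "'a::euclidean_space \<Rightarrow> 'b::topological_space"
  assumes "f \<in> borel_measurable lebesgue" "c \<noteq> 0"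
  shows "(\<lambda>x. f (t + c *\<^sub>R x)) \<in> borel_measurable lebesgue"
proof -
  have "(\<lambda>x. t + (\<Sum>j\<in>Basis. (c * (x \<bullet> j)) *\<^sub>R j)) \<in> lebesgue \<rightarrow>\<^sub>M lebesgue"
    using assms(2) by (intro lebesgue_affine_measurable) auto
  also have "(\<lambda>x. t + (\<Sum>j\<in>Basis. (c * (x \<bullet> j)) *\<^sub>R j)) = (\<lambda>x::'a. t + c *\<^sub>R x)"
    unfolding scaleR_scaleR[symmetric] scaleR_sum_right[symmetric] euclidean_representation ..
  finally show ?thesis
    by (rule measurable_compose) (rule assms)
qed

text \<open>Jensen's inequality, proved by integrating the tangent line of the \<open>q\<close>-th power at \<open>H / m\<close>.\<close>

lemma nn_integral_powr_le:
  fixes h :: "'a \<Rightarrow> real"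
  assumes [measurable]: "h \<in> borel_measurable M" "S \<in> sets M"
    and "\<And>x. 0 \<le> h x" and q: "0 < q" "q \<le> 1" and "0 < m" "0 < H"
    and m: "emeasure M S \<le> ennreal m" and H: "(\<integral>\<^sup>+ x. ennreal (h x) * indicator S x \<partial>M) \<le> ennreal H"
  shows "(\<integral>\<^sup>+ x. ennreal (h x powr q) * indicator S x \<partial>M) \<le> ennreal (m powr (1 - q) * H powr q)"
proof -
  define s where "s = H / m"
  have "s > 0"
    using assms by (simp add: s_def)
  have tangent: "h x powr q \<le> q * s powr (q - 1) * h x + (1 - q) * s powr q" for x
  proof (cases "h x = 0")
    case True
    then show ?thesis
      using q by simp
  next
    case False
    then have "h x > 0"
      using assms(3)[of x] by simp
    \<comment> \<open>Young's inequality with weights \<open>q\<close> and \<open>1 - q\<close> at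
      \<open>h x / s\<close> and 1 is the tangent line bound for the concave power at 1; multiplying
      by \<open>s powr q\<close> moves the point of tangency to \<open>s\<close>.\<close>
    have "(h x / s) powr q * 1 powr (1 - q) \<le> q * (h x / s) + (1 - q) * 1"
      using q \<open>h x > 0\<close> \<open>s > 0\<close> by (intro Youngs_inequality_0) auto
    then have "s powr q * (h x / s) powr q \<le> s powr q * (q * (h x / s) + (1 - q))"
      by (intro mult_left_mono) auto
    then show ?thesis
      using \<open>h x > 0\<close> \<open>s > 0\<close> by (simp add: powr_divide powr_diff field_simps)
  qed
  have "(\<integral>\<^sup>+ x. ennreal (h x powr q) * indicator S x \<partial>M)
      \<le> (\<integral>\<^sup>+ x. ennreal (q * s powr (q - 1)) * (ennreal (h x) * indicator S x)
            + ennreal ((1 - q) * s powr q) * indicator S x \<partial>M)"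
    using q assms(3) tangent
    by (intro nn_integral_mono) (auto simp: indicator_def ennreal_leI simp flip: ennreal_mult ennreal_plus)
  also have "\<dots> = ennreal (q * s powr (q - 1)) * (\<integral>\<^sup>+ x. ennreal (h x) * indicator S x \<partial>M)
      + ennreal ((1 - q) * s powr q) * emeasure M S"
    by (simp add: nn_integral_add nn_integral_cmult nn_integral_cmult_indicator)
  also have "\<dots> \<le> ennreal (q * s powr (q - 1)) * ennreal H + ennreal ((1 - q) * s powr q) * ennreal m"
    using m H by (intro add_mono mult_left_mono) auto
  also have "\<dots> = ennreal (q * s powr (q - 1) * H + (1 - q) * s powr q * m)"
    using q assms by (simp flip: ennreal_mult ennreal_plus)
  also have "q * s powr (q - 1) * H + (1 - q) * s powr q * m = m powr (1 - q) * H powr q"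
  proof -
    \<comment> \<open>For \<open>s = H / m\<close> both terms carry the same factor, and their
      weights \<open>q\<close> and \<open>1 - q\<close> add up to 1.\<close>
    have "s powr (q - 1) * H = m powr (1 - q) * H powr q" "s powr q * m = m powr (1 - q) * H powr q"
      using \<open>0 < m\<close> \<open>0 < H\<close> by (simp_all add: s_def powr_divide powr_diff field_simps)
    then show ?thesis
      by (simp add: algebra_simps)
  qed
  finally show ?thesis .
qed

text \<open>The integrand takes the junk value $0$ at the origin. Elsewhere the layer cake formula
  $|z|^{-s} = \int_{|z|}^\infty s u^{-s-1}\,du$ reduces the integral to volumes of balls.\<close>

lemma nn_integral_norm_powr_cball_le:
  fixes s r :: real
  defines "n \<equiv> DIM('a::euclidean_space)"
  assumes s: "0 < s" "s < n" and r: "0 < r"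
  shows "(\<integral>\<^sup>+ z. ennreal (norm (z::'a) powr (- s)) * indicator (cball 0 r) z \<partial>lborel)
    \<le> ennreal (unit_ball_vol n * n * r powr (n - s) / (n - s))"
proof -
  let ?V = "unit_ball_vol n"
  \<comment> \<open>The ball of radius \<open>min u r\<close> encodes both |z| <= u from the layer
    cake formula and |z| <= r from the domain, so that after Fubini the inner integral is the volume
    of one ball.\<close>
  let ?k = "\<lambda>z u. ennreal (s * u powr (- s - 1)) * indicator {0<..} u * indicator (cball (0::'a) (min u r)) z"
  have tail: "(\<integral>\<^sup>+ u. ennreal (s * u powr (- s - 1)) * indicator {a..} u \<partial>lborel) = ennreal (a powr (- s))"
    if "0 < a" for a
  proof -
    \<comment> \<open>The integrand has the antiderivative -u^(-s), which tends to 0 at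
      infinity.\<close>
    have "((\<lambda>u. - (u powr (- s))) \<longlongrightarrow> - 0) at_top"
      using s by (intro tendsto_minus tendsto_neg_powr filterlim_ident) auto
    then have "(\<integral>\<^sup>+ u. ennreal (s * u powr (- s - 1)) * indicator {a..} u \<partial>lborel) = ennreal (- 0 - (- (a powr (- s))))"
      using that s by (intro nn_integral_FTC_atLeast) (auto intro!: derivative_eq_intros)
    then show ?thesis
      by simp
  qed
  have "(\<integral>\<^sup>+ z. ennreal (norm (z::'a) powr (- s)) * indicator (cball 0 r) z \<partial>lborel)
      \<le> (\<integral>\<^sup>+ z. (\<integral>\<^sup>+ u. ?k z u \<partial>lborel) \<partial>lborel)"
  proof (intro nn_integral_mono)
    fix z :: 'a
    show "ennreal (norm z powr (- s)) * indicator (cball 0 r) z \<le> (\<integral>\<^sup>+ u. ?k z u \<partial>lborel)"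
    proof (cases "z = 0 \<or> z \<notin> cball 0 r")
      case False
      then have "ennreal (norm z powr (- s)) * indicator (cball 0 r) z
          = (\<integral>\<^sup>+ u. ennreal (s * u powr (- s - 1)) * indicator {norm z..} u \<partial>lborel)"
        by (simp add: tail)
      also have "\<dots> \<le> (\<integral>\<^sup>+ u. ?k z u \<partial>lborel)"
      proof (intro nn_integral_mono)
        fix u
        have "0 < norm z" using False by simp
        then show "ennreal (s * u powr (- s - 1)) * indicator {norm z..} u \<le> ?k z u"
          using False by (auto simp: indicator_def simp del: zero_less_norm_iff)
      qed
      finally show ?thesis .
    qed auto
  qed
  also have "\<dots> = (\<integral>\<^sup>+ u. (\<integral>\<^sup>+ z. ?k z u \<partial>lborel) \<partial>lborel)"
  proof (rule lborel_pair.Fubini'[symmetric])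
    \<comment> \<open>Expressed as a condition on \<open>norm z\<close>, the indicator of a ball
      whose radius depends on \<open>u\<close> is visibly jointly measurable.\<close>
    have "?k z u = ennreal (s * u powr (- s - 1)) * indicator {0<..} u * (if norm z \<le> min u r then 1 else 0)" for z u
      by (auto simp: indicator_def)
    then show "(\<lambda>(z, u). ?k z u) \<in> borel_measurable (lborel \<Otimes>\<^sub>M lborel)"
      by simp
  qed
  \<comment> \<open>The integral splits at u = r: below, the volume grows like u^n; above, it stays
    at that of the ball of radius \<open>r\<close>. Both indicators contain the point r, which is
    harmless for an upper bound.\<close>
  also have "\<dots> \<le> (\<integral>\<^sup>+ u. ennreal (?V * s) * (ennreal (u powr (n - s - 1)) * indicator {0..r} u)
      + ennreal (?V * r ^ n) * (ennreal (s * u powr (- s - 1)) * indicator {r..} u) \<partial>lborel)"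
  proof (intro nn_integral_mono)
    fix u :: real
    have "(\<integral>\<^sup>+ z. ?k z u \<partial>lborel) = ennreal (s * u powr (- s - 1)) * indicator {0<..} u * emeasure lborel (cball (0::'a) (min u r))"
      by (intro nn_integral_cmult_indicator) simp
    also have "\<dots> \<le> ennreal (?V * s) * (ennreal (u powr (n - s - 1)) * indicator {0..r} u)
      + ennreal (?V * r ^ n) * (ennreal (s * u powr (- s - 1)) * indicator {r..} u)"
    proof (cases "u \<le> 0")
      case False
      show ?thesis
      proof (cases "u \<le> r")
        case True
        have "s * u powr (- s - 1) * (?V * u ^ n) = ?V * s * u powr (n - s - 1)"
          using False by (simp add: powr_realpow[symmetric] algebra_simps flip: powr_add)
        then have "ennreal (s * u powr (- s - 1)) * indicator {0<..} u * emeasure lborel (cball (0::'a) (min u r))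
           = ennreal (?V * s) * (ennreal (u powr (n - s - 1)) * indicator {0..r} u)"
          using True False s by (simp add: emeasure_cball min_def n_def flip: ennreal_mult)
        then show ?thesis
          by simp
      next
        case r': False
        have "ennreal (s * u powr (- s - 1)) * indicator {0<..} u * emeasure lborel (cball (0::'a) (min u r))
           = ennreal (?V * r ^ n) * (ennreal (s * u powr (- s - 1)) * indicator {r..} u)"
          using r r' False s by (simp add: emeasure_cball min_def n_def ac_simps flip: ennreal_mult)
        then show ?thesis
          by simp
      qed
    qed auto
    finally show "(\<integral>\<^sup>+ z. ?k z u \<partial>lborel) \<le> ennreal (?V * s) * (ennreal (u powr (n - s - 1)) * indicator {0..r} u)
      + ennreal (?V * r ^ n) * (ennreal (s * u powr (- s - 1)) * indicator {r..} u)" .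
  qed
  also have "\<dots> = ennreal (?V * s) * (\<integral>\<^sup>+ u. (ennreal (u powr (n - s - 1)) * indicator {0..r} u) \<partial>lborel)
      + ennreal (?V * r ^ n) * ennreal (r powr (- s))"
    using r by (simp add: nn_integral_add nn_integral_cmult tail)
  also have "(\<integral>\<^sup>+ u. (ennreal (u powr (n - s - 1)) * indicator {0..r} u) \<partial>lborel)
      = ennreal (r powr (n - s - 1 + 1) / (n - s - 1 + 1))"
    using s r by (intro nn_integral_has_integral_lebesgue' has_integral_powr_from_0) auto
  also have "ennreal (?V * s) * \<dots> + ennreal (?V * r ^ n) * ennreal (r powr (- s))
      = ennreal (?V * s * (r powr (n - s) / (n - s)) + ?V * r ^ n * r powr (- s))"
    using s r by (simp flip: ennreal_mult ennreal_plus)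
  \<comment> \<open>The two contributions s/(n - s) and 1 add up to n/(n - s).\<close>
  also have "?V * s * (r powr (n - s) / (n - s)) + ?V * r ^ n * r powr (- s) = ?V * n * r powr (n - s) / (n - s)"
    using s r by (simp add: powr_realpow[symmetric] powr_diff powr_minus field_simps)
  finally show ?thesis .
qed

section \<open>Normalised measure in terms of Lebesgue measure\<close>

lemma nn_integral_mu:
  fixes h :: "'a::euclidean_space \<Rightarrow> ennreal"
  assumes "h \<in> borel_measurable lebesgue"
  shows "(\<integral>\<^sup>+ x. h x \<partial>mu) = ennreal (1 / (2 * pi) powr (DIM('a) / 2)) * (\<integral>\<^sup>+ x. h x \<partial>lborel)"
  using assms unfolding nn_integral_completion[of lborel h, symmetric]
  by (simp add: mu_def nn_integral_density nn_integral_cmult)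

lemma integral_mu:
  fixes h :: "'a::euclidean_space \<Rightarrow> 'b::{banach, second_countable_topology}"
  assumes "h \<in> borel_measurable lebesgue"
  shows "(\<integral> x. h x \<partial>mu) = (1 / (2 * pi) powr (DIM('a) / 2)) *\<^sub>R (\<integral> x. h x \<partial>lebesgue)"
  using assms by (simp add: mu_def integral_density)

lemma AE_mu: "(AE x in mu. P x) \<longleftrightarrow> (AE x in lborel. P (x::'a::euclidean_space))"
  unfolding mu_def by (subst AE_density) (simp_all add: AE_completion_iff)

lemma sets_mu [simp, measurable_cong]: "sets mu = sets lebesgue"
  by (simp add: mu_def)

section \<open>The quaternion Wigner transform\<close>

lemma bounded_linear_qcnj: "bounded_linear qcnj"
  by (simp add: linear_conv_bounded_linear[symmetric]) (auto intro!: linearI simp: quat_eq_iff)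

lemma norm_qcnj [simp]: "norm (qcnj x) = norm x"
  by (simp add: norm_quat_def)

text \<open>The exponential series lives in a noncommutative algebra, where the library has no formula for the
  norm; the squared norm has derivative $0$ since \<open>x * q\<close> is orthogonal to \<open>x\<close> for imaginary \<open>q\<close>.\<close>

lemma norm_exp_scaleR_quat:
  fixes q :: quat
  assumes "qRe q = 0"
  shows "norm (exp (a *\<^sub>R q)) = 1"
proof -
  let ?h = "\<lambda>a. exp (a *\<^sub>R q)"
  have orth: "x \<bullet> (x * q) = 0" for x
    using assms by (simp add: inner_quat_def algebra_simps)
  have "((\<lambda>a. ?h a \<bullet> ?h a) has_real_derivative 0) (at a)" for a
    using has_derivative_inner[OF exp_scaleR_has_vector_derivative_right[of q a UNIV, unfolded has_vector_derivative_def]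
        exp_scaleR_has_vector_derivative_right[of q a UNIV, unfolded has_vector_derivative_def]]
    by (simp add: has_field_derivative_def orth inner_commute[of "x * q" for x] lambda_zero)
  then have "?h a \<bullet> ?h a = ?h 0 \<bullet> ?h 0"
    by (intro DERIV_isconst_all) blast
  then show ?thesis
    by (simp add: norm_eq_sqrt_inner inner_quat_def)
qed

text \<open>Differentiability in the real parameter gives continuity. This one-parameter family
  suffices, since the exponents in the kernel are real multiples of fixed units.\<close>

lemma borel_measurable_exp_quat:
  fixes q :: quat
  shows "(\<lambda>a. exp (- (a *\<^sub>R q))) \<in> borel_measurable borel"
proof -
  have "continuous_on UNIV (\<lambda>a. exp (a *\<^sub>R (- q)))"
    using exp_scaleR_has_vector_derivative_right[of "- q" _ UNIV]
    by (intro continuous_on_vector_derivative) auto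
  then show ?thesis
    by (simp add: borel_measurable_continuous_onI)
qed

text \<open>Both arguments have the form \<open>x + c *\<^sub>R t\<close> with c = 1/2 or c = -1/2,
  so that the affine substitution lemmas apply to \<open>f\<close> and \<open>g\<close>
  alike.\<close>

definition wigner_kernel :: "('d::finite R2d \<Rightarrow> quat) \<Rightarrow> ('d R2d \<Rightarrow> quat) \<Rightarrow> 'd R2d \<times> 'd R2d \<Rightarrow> 'd R2d \<Rightarrow> quat" where
  "wigner_kernel f g z t = exp (- ((fst (snd z) \<bullet> fst t) *\<^sub>R quat_i)) * f (fst z + (1/2) *\<^sub>R t)
     * qcnj (g (fst z + (-1/2) *\<^sub>R t)) * exp (- ((snd (snd z) \<bullet> snd t) *\<^sub>R quat_j))"

lemma wigner_eq: "wigner f g z = (\<integral>t. wigner_kernel f g z t \<partial>mu)"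
  by (simp add: wigner_def wigner_kernel_def split_beta)

text \<open>The quaternion norm is multiplicative and conjugation preserves it; both exponentials
  have norm 1 because their exponents are purely imaginary.\<close>

lemma norm_wigner_kernel:
  "norm (wigner_kernel f g z t) = norm (f (fst z + (1/2) *\<^sub>R t)) * norm (g (fst z + (-1/2) *\<^sub>R t))"
proof -
  have "norm (exp (- (a *\<^sub>R q))) = 1" if "qRe q = 0" for a and q :: quat
    using norm_exp_scaleR_quat[OF that, of "- a"] by simp
  then show ?thesis
    by (simp add: wigner_kernel_def norm_mult quat_i_def quat_j_def)
qed

lemma borel_measurable_wigner_kernel:
  fixes f g :: "'d::finite R2d \<Rightarrow> quat"
  assumes [measurable]: "f \<in> borel_measurable borel" "g \<in> borel_measurable borel"
  shows "(\<lambda>(z, t). wigner_kernel f g z t) \<in> borel_measurable (borel \<Otimes>\<^sub>M borel)"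
proof -
  have [measurable]: "qcnj \<in> borel_measurable borel"
    by (intro borel_measurable_continuous_onI linear_continuous_on bounded_linear_qcnj)
  have [measurable]: "fst \<in> borel_measurable (borel :: ('d R2d \<times> 'd R2d) measure)"
      "snd \<in> borel_measurable (borel :: ('d R2d \<times> 'd R2d) measure)"
      "fst \<in> borel_measurable (borel :: 'd R2d measure)"
      "snd \<in> borel_measurable (borel :: 'd R2d measure)"
    by (auto intro!: borel_measurable_continuous_onI continuous_intros)
  note [measurable] = borel_measurable_exp_quat[THEN measurable_compose[rotated]]
  show ?thesis
    unfolding wigner_kernel_def split_beta by measurable
qed

lemma wigner_kernel_AE_eq:
  fixes f g :: "'d::finite R2d \<Rightarrow> quat"
  assumes "AE x in lborel. f x = f' x" "AE x in lborel. g x = g' x"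
  shows "AE t in lborel. wigner_kernel f g z t = wigner_kernel f' g' z t"
proof -
  have "AE t in lborel. f (fst z + (1/2) *\<^sub>R t) = f' (fst z + (1/2) *\<^sub>R t)"
    by (rule AE_lborel_affine[OF _ assms(1)]) simp
  moreover have "AE t in lborel. g (fst z + (-1/2) *\<^sub>R t) = g' (fst z + (-1/2) *\<^sub>R t)"
    by (rule AE_lborel_affine[OF _ assms(2)]) simp
  ultimately show ?thesis
    by eventually_elim (simp only: wigner_kernel_def)
qed

lemma borel_measurable_lebesgue_AE_eq:
  fixes h h' :: "'a::euclidean_space \<Rightarrow> 'b::euclidean_space"
  assumes "h' \<in> borel_measurable borel" "AE x in lborel. h x = h' x"
  shows "h \<in> borel_measurable lebesgue"
proof (rule borel_measurable_AE)
  show "h' \<in> borel_measurable lebesgue"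
    using assms(1) by (simp add: measurable_completion)
  show "AE x in lebesgue. h' x = h x"
    using assms(2) by (auto simp: AE_completion_iff)
qed

text \<open>Passing to Borel representatives changes the kernel only on a null set of
  \<open>t\<close> for every single \<open>z\<close>, so the transform itself is unchanged
  everywhere. It is then a parameter integral of a jointly measurable function.\<close>

lemma borel_measurable_wigner:
  fixes f g :: "'d::finite R2d \<Rightarrow> quat"
  assumes f: "f \<in> borel_measurable lebesgue" and g: "g \<in> borel_measurable lebesgue"
  shows "wigner f g \<in> borel_measurable borel"
proof -
  obtain f' where f'[measurable]: "f' \<in> borel_measurable borel" and ff': "AE x in lborel. f x = f' x"
    using lebesgue_borel_version[OF f] by blast
  obtain g' where g'[measurable]: "g' \<in> borel_measurable borel" and gg': "AE x in lborel. g x = g' x"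
    using lebesgue_borel_version[OF g] by blast
  let ?c = "1 / (2 * pi) powr (DIM('d R2d) / 2)"
  have *: "wigner_kernel f' g' z \<in> borel_measurable borel" for z
    using measurable_compose[OF _ borel_measurable_wigner_kernel[OF f' g'], of "\<lambda>t. (z, t)" borel]
    by (simp add: measurable_Pair1')
  have "wigner f g = (\<lambda>z. ?c *\<^sub>R (\<integral>t. wigner_kernel f' g' z t \<partial>lborel))"
  proof
    fix z
    have ae: "AE t in lborel. wigner_kernel f g z t = wigner_kernel f' g' z t"
      by (rule wigner_kernel_AE_eq[OF ff' gg'])
    have "wigner f g z = ?c *\<^sub>R (\<integral>t. wigner_kernel f g z t \<partial>lebesgue)"
      unfolding wigner_eq by (intro integral_mu borel_measurable_lebesgue_AE_eq[OF * ae])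
    also have "(\<integral>t. wigner_kernel f g z t \<partial>lebesgue) = (\<integral>t. wigner_kernel f' g' z t \<partial>lebesgue)"
    proof (rule integral_cong_AE)
      show "wigner_kernel f g z \<in> borel_measurable lebesgue"
        by (rule borel_measurable_lebesgue_AE_eq[OF * ae])
      show "wigner_kernel f' g' z \<in> borel_measurable lebesgue"
        using *[of z] by (intro measurable_completion) (simp only: measurable_lborel1 measurable_lborel2)
      show "AE t in lebesgue. wigner_kernel f g z t = wigner_kernel f' g' z t"
        using ae by (simp only: AE_completion_iff)
    qed
    also have "\<dots> = (\<integral>t. wigner_kernel f' g' z t \<partial>lborel)"
      by (intro integral_completion) (simp only: measurable_lborel1 measurable_lborel2 *)
    finally show "wigner f g z = ?c *\<^sub>R (\<integral>t. wigner_kernel f' g' z t \<partial>lborel)" .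
  qed
  moreover have "(\<lambda>z. ?c *\<^sub>R (\<integral>t. wigner_kernel f' g' z t \<partial>lborel)) \<in> borel_measurable borel"
  proof -
    have "(\<lambda>(z, t). wigner_kernel f' g' z t) \<in> borel_measurable (borel \<Otimes>\<^sub>M lborel)"
      by (subst measurable_cong_sets[OF sets_pair_measure_cong[OF refl sets_lborel] refl])
         (rule borel_measurable_wigner_kernel[OF f' g'])
    then show ?thesis
      by (intro borel_measurable_scaleR borel_measurable_const lborel.borel_measurable_lebesgue_integral)
  qed
  ultimately show ?thesis
    by (simp only:)
qed

section \<open>Pointwise bound for the Wigner transform\<close>

lemma nn_integral_scale_mu:
  fixes f :: "'a::euclidean_space \<Rightarrow> 'b::euclidean_space"
  assumes f: "f \<in> borel_measurable lebesgue" and c: "c \<noteq> 0"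
  shows "ennreal (\<bar>c\<bar> ^ DIM('a)) * (\<integral>\<^sup>+ t. ennreal (norm (f (x + c *\<^sub>R t)))^2 \<partial>mu) = (\<integral>\<^sup>+ t. ennreal (norm (f t))^2 \<partial>mu)"
proof -
  obtain f' where f'[measurable]: "f' \<in> borel_measurable borel" and ff': "AE x in lborel. f x = f' x"
    using lebesgue_borel_version[OF f] by blast
  note [measurable] = f lebesgue_measurable_affine[OF f c]
  have "(\<integral>\<^sup>+ t. ennreal (norm (f (x + c *\<^sub>R t)))^2 \<partial>lborel) = (\<integral>\<^sup>+ t. ennreal (norm (f' (x + c *\<^sub>R t)))^2 \<partial>lborel)"
    using AE_lborel_affine[OF c ff', of x] by (intro nn_integral_cong_AE) auto
  moreover have "(\<integral>\<^sup>+ t. ennreal (norm (f t))^2 \<partial>lborel) = (\<integral>\<^sup>+ t. ennreal (norm (f' t))^2 \<partial>lborel)"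
    using ff' by (intro nn_integral_cong_AE) auto
  moreover have "(\<integral>\<^sup>+ t. ennreal (norm (f' t))^2 \<partial>lborel)
      = ennreal (\<bar>c\<bar> ^ DIM('a)) * (\<integral>\<^sup>+ t. ennreal (norm (f' (x + c *\<^sub>R t)))^2 \<partial>lborel)"
    using c by (intro nn_integral_lborel_affine) auto
  ultimately show ?thesis
    by (simp add: nn_integral_mu mult.left_commute)
qed

lemma ennreal_power2_le_imp_le:
  assumes "0 \<le> c" "x\<^sup>2 \<le> (ennreal c)\<^sup>2"
  shows "x \<le> ennreal c"
proof (cases x)
  case (real a)
  then have "a\<^sup>2 \<le> c\<^sup>2"
    using assms by (simp add: ennreal_power)
  then show ?thesis
    using real assms(1) power2_le_imp_le by (simp add: ennreal_leI)
next
  case top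
  then show ?thesis
    using assms by (simp add: ennreal_power top_unique)
qed

text \<open>Cauchy-Schwarz in \<open>t\<close>. Each substitution with factor 1/2 or -1/2 in
  dimension 2d multiplies a squared norm by 2^(2d); the square root of the product of the two
  factors is again 2^(2d).\<close>

lemma norm_wigner_le:
  fixes f g :: "'d::finite R2d \<Rightarrow> quat"
  assumes f: "f \<in> borel_measurable lebesgue" and g: "g \<in> borel_measurable lebesgue"
    and F: "(\<integral>\<^sup>+ t. ennreal (norm (f t))^2 \<partial>mu) = ennreal (F^2)" "0 \<le> F"
    and G: "(\<integral>\<^sup>+ t. ennreal (norm (g t))^2 \<partial>mu) = ennreal (G^2)" "0 \<le> G"
  shows "norm (wigner f g z) \<le> 2 ^ (2 * CARD('d)) * F * G"
proof -
  let ?n = "2 * CARD('d)"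
  have scaled: "(\<integral>\<^sup>+ t. ennreal (norm (h (fst z + c *\<^sub>R t)))^2 \<partial>mu) = ennreal (2 ^ ?n * A^2)"
    if h: "h \<in> borel_measurable lebesgue" "(\<integral>\<^sup>+ t. ennreal (norm (h t))^2 \<partial>mu) = ennreal (A^2)" and c: "\<bar>c\<bar> = 1/2"
    for h :: "'d R2d \<Rightarrow> quat" and A c
  proof -
    have "c \<noteq> 0"
      using c by auto
    have "ennreal (\<bar>c\<bar> ^ ?n) * (\<integral>\<^sup>+ t. ennreal (norm (h (fst z + c *\<^sub>R t)))^2 \<partial>mu) = ennreal (A^2)"
      using nn_integral_scale_mu[OF h(1) \<open>c \<noteq> 0\<close>, of "fst z"] unfolding h(2) by (simp add: mult_2)
    then have "ennreal (2 ^ ?n) * ennreal (\<bar>c\<bar> ^ ?n) * (\<integral>\<^sup>+ t. ennreal (norm (h (fst z + c *\<^sub>R t)))^2 \<partial>mu)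
        = ennreal (2 ^ ?n) * ennreal (A^2)"
      by (simp only: mult.assoc)
    moreover have "ennreal (2 ^ ?n) * ennreal (\<bar>c\<bar> ^ ?n) = 1"
    proof -
      have "ennreal (2 ^ ?n) * ennreal (\<bar>c\<bar> ^ ?n) = ennreal (2 ^ ?n * \<bar>c\<bar> ^ ?n)"
        by (rule ennreal_mult[symmetric]) auto
      also have "2 ^ ?n * \<bar>c\<bar> ^ ?n = (2 * \<bar>c\<bar>) ^ ?n"
        by (rule power_mult_distrib[symmetric])
      also have "2 * \<bar>c\<bar> = 1"
        using c by simp
      finally show ?thesis
        by simp
    qed
    moreover have "ennreal (2 ^ ?n * A^2) = ennreal (2 ^ ?n) * ennreal (A^2)"
      by (rule ennreal_mult) auto
    ultimately show ?thesis
      by (simp only: mult_1)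
  qed
  have meas: "(\<lambda>t. ennreal (norm (h (fst z + c *\<^sub>R t)))) \<in> borel_measurable mu"
    if "h \<in> borel_measurable lebesgue" "\<bar>c\<bar> = 1/2" for h :: "'d R2d \<Rightarrow> quat" and c
  proof -
    have [measurable]: "(\<lambda>t. h (fst z + c *\<^sub>R t)) \<in> borel_measurable lebesgue"
      by (rule lebesgue_measurable_affine[OF that(1)]) (use that(2) in auto)
    show ?thesis
      by measurable
  qed
  have "(\<integral>\<^sup>+ t. ennreal (norm (wigner_kernel f g z t)) \<partial>mu)\<^sup>2
      = (\<integral>\<^sup>+ t. ennreal (norm (f (fst z + (1/2) *\<^sub>R t))) * ennreal (norm (g (fst z + (-1/2) *\<^sub>R t))) \<partial>mu)\<^sup>2"
    by (simp only: norm_wigner_kernel ennreal_mult[OF norm_ge_zero norm_ge_zero])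
  also have "\<dots> \<le> (\<integral>\<^sup>+ t. (ennreal (norm (f (fst z + (1/2) *\<^sub>R t))))\<^sup>2 \<partial>mu)
      * (\<integral>\<^sup>+ t. (ennreal (norm (g (fst z + (-1/2) *\<^sub>R t))))\<^sup>2 \<partial>mu)"
    by (intro Cauchy_Schwarz_nn_integral meas f g) auto
  also have "\<dots> = ennreal (2 ^ ?n * F^2) * ennreal (2 ^ ?n * G^2)"
    by (subst scaled[OF f F(1)], simp, subst scaled[OF g G(1)], simp, rule refl)
  also have "\<dots> = (ennreal (2 ^ ?n * F * G))\<^sup>2"
    using F(2) G(2) by (simp add: ennreal_power power2_eq_square ac_simps flip: ennreal_mult)
  finally have "(\<integral>\<^sup>+ t. ennreal (norm (wigner_kernel f g z t)) \<partial>mu) \<le> ennreal (2 ^ ?n * F * G)"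
    by (intro ennreal_power2_le_imp_le) (use F(2) G(2) in auto)
  \<comment> \<open>If the kernel is not integrable, the Bochner integral has the default value 0
    and the bound is trivial.\<close>
  moreover have "ennreal (norm (wigner f g z)) \<le> (\<integral>\<^sup>+ t. ennreal (norm (wigner_kernel f g z t)) \<partial>mu)"
    unfolding wigner_eq by (cases "integrable mu (wigner_kernel f g z)")
      (auto simp: integral_norm_bound_ennreal not_integrable_integral_eq)
  ultimately have "ennreal (norm (wigner f g z)) \<le> ennreal (2 ^ ?n * F * G)"
    by (rule order_trans[rotated])
  then show ?thesis
    using F(2) G(2) by (subst (asm) ennreal_le_iff) auto
qed

section \<open>Local uncertainty\<close>

lemma powr_superadditive:
  fixes x y p :: real
  assumes "0 < x" "0 < y" "1 \<le> p"
  shows "x powr p + y powr p \<le> (x + y) powr p"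
proof -
  have *: "u powr p = u * u powr (p - 1)" if "0 < u" for u :: real
    using that by (simp add: powr_diff)
  have "x * x powr (p - 1) + y * y powr (p - 1) \<le> x * (x + y) powr (p - 1) + y * (x + y) powr (p - 1)"
    using assms by (intro add_mono mult_left_mono powr_mono2) auto
  then show ?thesis
    using assms by (simp add: * distrib_right)
qed

text \<open>The radius \<open>r\<close> below minimises the left-hand side.\<close>

lemma powr_balance:
  fixes a b \<alpha> \<beta> :: real
  assumes "0 < a" "0 < b" "0 < \<alpha>" "0 < \<beta>"
  defines "\<theta> \<equiv> \<beta> / (\<alpha> + \<beta>)"
  obtains r where "0 < r"
    "a * r powr \<alpha> + b * r powr (- \<beta>) = a powr \<theta> * b powr (1 - \<theta>) * ((\<alpha> + \<beta>) / (\<alpha> powr (1 - \<theta>) * \<beta> powr \<theta>))"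
proof -
  \<comment> \<open>The derivative vanishes when a \<alpha> r^\<alpha> = b \<beta> r^(-\<beta>),
    that is, when r^(\<alpha> + \<beta>) equals \<open>u\<close>.\<close>
  define u where "u = b * \<beta> / (a * \<alpha>)"
  have u: "u > 0" using assms by (simp add: u_def)
  define r where "r = u powr (1 / (\<alpha> + \<beta>))"
  have "\<alpha> / (\<alpha> + \<beta>) = 1 - \<theta>"
    using assms by (simp add: \<theta>_def field_simps)
  then have "r powr \<alpha> = u powr (1 - \<theta>)" "r powr (- \<beta>) = u powr (- \<theta>)"
    by (simp_all add: r_def powr_powr \<theta>_def)
  then have "a * r powr \<alpha> + b * r powr (- \<beta>) = u powr (- \<theta>) * (a * u + b)"
    using u by (simp add: powr_diff powr_minus field_simps)
  also have "a * u + b = b * (\<alpha> + \<beta>) / \<alpha>"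
    using assms by (simp add: u_def field_simps)
  also have "u powr (- t) * (b * (\<alpha> + \<beta>) / \<alpha>)
      = a powr t * b powr (1 - t) * ((\<alpha> + \<beta>) / (\<alpha> powr (1 - t) * \<beta> powr t))" for t
    using assms(1-4) by (simp add: u_def powr_divide powr_mult powr_diff powr_minus divide_simps)
  finally show ?thesis
    using that[of r] u by (simp add: r_def)
qed

lemma powr_square: "(x powr a)\<^sup>2 = x powr (2 * a :: real)"
  by (simp add: power2_eq_square flip: powr_add)

text \<open>The factor K(\<epsilon>) r^(n - 2\<epsilon>) bounds the \<open>mu\<close>-integral of
  |z|^(-2\<epsilon>) over the ball of radius \<open>r\<close>. The bound is the p-th power of a
  multiple of a r^\<alpha> + b r^(-\<beta>), the shape that \<open>powr_balance\<close>
  optimises.\<close>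

lemma nn_integral_local_uncertainty:
  fixes W :: "'a::euclidean_space \<Rightarrow> 'b::euclidean_space"
  defines "n \<equiv> DIM('a)"
  defines "K \<equiv> \<lambda>\<epsilon>. unit_ball_vol n * n / ((n - 2 * \<epsilon>) * (2 * pi) powr (n / 2))"
  assumes W [measurable]: "W \<in> borel_measurable borel" and S [measurable]: "S \<in> sets lebesgue"
    and \<epsilon>: "0 < \<epsilon>" "2 * \<epsilon> < n" and p: "1 \<le> p"
    and L: "0 < L" "\<And>z. norm (W z) \<le> L"
    and M: "0 < M" "(\<integral>\<^sup>+ z. ennreal (norm z powr \<epsilon> * norm (W z))^2 \<partial>mu) \<le> ennreal (M^2)"
    and m: "0 < m" "emeasure mu S \<le> ennreal m" and r: "0 < r"
  shows "(\<integral>\<^sup>+ z. ennreal (norm (W z) powr p) * indicator S z \<partial>mu)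
    \<le> ennreal ((m powr (1 / (p * (p + 1)))
        * ((L powr (p / (p + 1)) * (M * sqrt (K \<epsilon>)) powr (1 / (p + 1))) * r powr ((n / 2 - \<epsilon>) / (p + 1))
           + (L powr ((p - 1) / (p + 1)) * M powr (2 / (p + 1))) * r powr (- (2 * \<epsilon> / (p + 1))))) powr p)"
proof -
  define q where "q = p / (p + 1)"
  \<comment> \<open>The third claim is where p >= 1 enters: p - 2q = p(p - 1)/(p + 1).\<close>
  have q: "0 < q" "q \<le> 1" "0 \<le> p - 2 * q" "q \<le> p"
    using p by (auto simp: q_def field_simps)
  let ?c = "1 / (2 * pi) powr (n / 2)"
  have K: "0 < K \<epsilon>"
    using \<epsilon> by (simp add: K_def n_def)
  have [measurable]: "W \<in> borel_measurable lebesgue" "(\<lambda>z::'a. z) \<in> borel_measurable lebesgue"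
    using W by (auto simp: measurable_completion)
  define H where "H = M * sqrt (K \<epsilon>) * r powr (n / 2 - \<epsilon>)"
  have "H > 0"
    using M K r by (simp add: H_def)
  have [measurable]: "(cball 0 r :: 'a set) \<in> sets lebesgue"
    by simp
  have near: "(\<integral>\<^sup>+ z. ennreal (norm (W z)) * indicator (cball 0 r) z \<partial>mu) \<le> ennreal H"
  proof -
    \<comment> \<open>Inserting |z|^\<epsilon> |z|^(-\<epsilon>) = 1 fails at the origin, where both
      powers are 0; this single point is a null set.\<close>
    have "AE z in mu. z \<noteq> (0::'a)"
      by (simp add: AE_mu AE_lborel_singleton)
    then have "(\<integral>\<^sup>+ z. ennreal (norm (W z)) * indicator (cball 0 r) z \<partial>mu)
      = (\<integral>\<^sup>+ z. ennreal (norm z powr \<epsilon> * norm (W z)) * (ennreal (norm z powr (- \<epsilon>)) * indicator (cball 0 r) z) \<partial>mu)"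
      by (intro nn_integral_cong_AE, eventually_elim)
         (simp add: indicator_def powr_minus mult_ac flip: ennreal_mult)
    also have "\<dots>\<^sup>2 \<le> ennreal (M^2) * (\<integral>\<^sup>+ z. (ennreal (norm z powr (- \<epsilon>)) * indicator (cball 0 r) z)^2 \<partial>(mu :: 'a measure))"
      by (rule order_trans[OF Cauchy_Schwarz_nn_integral]) (measurable, intro mult_right_mono M, simp)
    also have "(\<integral>\<^sup>+ z. (ennreal (norm z powr (- \<epsilon>)) * indicator (cball 0 r) z)^2 \<partial>(mu :: 'a measure))
        = (\<integral>\<^sup>+ z. ennreal (norm z powr (- (2 * \<epsilon>))) * indicator (cball 0 r) z \<partial>(mu :: 'a measure))"
      by (intro nn_integral_cong) (auto simp: indicator_def ennreal_power powr_square)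
    also have "\<dots> = ennreal ?c * (\<integral>\<^sup>+ z. ennreal (norm (z::'a) powr (- (2 * \<epsilon>))) * indicator (cball 0 r) z \<partial>lborel)"
      unfolding n_def by (intro nn_integral_mu) measurable
    also have "\<dots> \<le> ennreal ?c * ennreal (unit_ball_vol n * n * r powr (n - 2 * \<epsilon>) / (n - 2 * \<epsilon>))"
      unfolding n_def using \<epsilon> r
      by (intro mult_left_mono nn_integral_norm_powr_cball_le) (auto simp: n_def)
    also have "ennreal (M^2) * \<dots> = ennreal (M^2 * (?c * (unit_ball_vol n * n * r powr (n - 2 * \<epsilon>) / (n - 2 * \<epsilon>))))"
      using \<epsilon> M by (simp flip: ennreal_mult)
    also have "M^2 * (?c * (unit_ball_vol n * n * r powr (n - 2 * \<epsilon>) / (n - 2 * \<epsilon>))) = H^2"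
      using K r by (simp add: H_def power_mult_distrib powr_square) (simp add: K_def field_simps)
    also have "ennreal (H^2) = (ennreal H)^2"
      using \<open>H > 0\<close> by (simp add: ennreal_power)
    finally have "(\<integral>\<^sup>+ z. ennreal (norm (W z)) * indicator (cball 0 r) z \<partial>mu)\<^sup>2 \<le> (ennreal H)\<^sup>2"
      by (simp add: mult_left_mono)
    then show ?thesis
      using \<open>H > 0\<close> by (intro ennreal_power2_le_imp_le) auto
  qed
  have far: "(\<integral>\<^sup>+ z. ennreal ((norm (W z))^2) * indicator (- cball 0 r) z \<partial>mu) \<le> ennreal (r powr (- (2 * \<epsilon>)) * M^2)"
  proof -
    have "(\<integral>\<^sup>+ z. ennreal ((norm (W z))^2) * indicator (- cball 0 r) z \<partial>mu)
        \<le> (\<integral>\<^sup>+ z. ennreal (r powr (- (2 * \<epsilon>))) * ennreal (norm z powr \<epsilon> * norm (W z))^2 \<partial>mu)"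
    proof (intro nn_integral_mono)
      fix z :: 'a
      \<comment> \<open>A Chebyshev estimate: outside the ball the weight |z|^(2\<epsilon>) is at
        least r^(2\<epsilon>).\<close>
      have "(norm (W z))^2 \<le> r powr (- (2 * \<epsilon>)) * (norm z powr \<epsilon> * norm (W z))^2" if "r < norm z"
      proof -
        have "r powr (2 * \<epsilon>) \<le> norm z powr (2 * \<epsilon>)"
          using that r \<epsilon> by (intro powr_mono2) auto
        then have "1 \<le> r powr (- (2 * \<epsilon>)) * norm z powr (2 * \<epsilon>)"
          using r by (simp add: powr_minus field_simps)
        then have "1 * (norm (W z))^2 \<le> r powr (- (2 * \<epsilon>)) * norm z powr (2 * \<epsilon>) * (norm (W z))^2"
          by (intro mult_right_mono) auto
        then show ?thesis
          by (simp add: power_mult_distrib powr_square mult.assoc)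
      qed
      then show "ennreal ((norm (W z))^2) * indicator (- cball 0 r) z
          \<le> ennreal (r powr (- (2 * \<epsilon>))) * ennreal (norm z powr \<epsilon> * norm (W z))^2"
        by (auto simp: indicator_def ennreal_power intro!: ennreal_leI simp flip: ennreal_mult)
    qed
    also have "\<dots> = ennreal (r powr (- (2 * \<epsilon>))) * (\<integral>\<^sup>+ z. ennreal (norm z powr \<epsilon> * norm (W z))^2 \<partial>mu)"
      by (intro nn_integral_cmult) measurable
    also have "\<dots> \<le> ennreal (r powr (- (2 * \<epsilon>))) * ennreal (M^2)"
      by (intro mult_left_mono M) auto
    finally show ?thesis
      by (simp add: ennreal_mult)
  qed
  \<comment> \<open>Used with k = 1 inside the ball and k = 2 outside: |W|^p <= L^(p - kq)
    (|W|^k)^q. The indicator of \<open>A\<close> may enter the q-th power as it only takes the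
    values 0 and 1, so Jensen's inequality is applied over \<open>S\<close>.\<close>
  have piece: "(\<integral>\<^sup>+ z. ennreal (norm (W z) powr p) * indicator (S \<inter> A) z \<partial>mu)
      \<le> ennreal (L powr (p - k * q) * (m powr (1 - q) * H' powr q))"
    if A [measurable]: "A \<in> sets borel" and k: "0 < k" "0 \<le> p - k * q" and "0 < H'"
      and H': "(\<integral>\<^sup>+ z. ennreal (norm (W z) powr k) * indicator A z \<partial>mu) \<le> ennreal H'"
    for A k H'
  proof -
    have [measurable]: "A \<in> sets lebesgue"
      using A by simp
    have "(\<integral>\<^sup>+ z. ennreal (norm (W z) powr p) * indicator (S \<inter> A) z \<partial>mu)
        \<le> (\<integral>\<^sup>+ z. ennreal (L powr (p - k * q)) * (ennreal ((norm (W z) powr k * indicator A z) powr q) * indicator S z) \<partial>mu)"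
    proof (intro nn_integral_mono)
      fix z
      have "norm (W z) powr p \<le> L powr (p - k * q) * norm (W z) powr (k * q)"
      proof -
        have "norm (W z) powr p = norm (W z) powr (p - k * q) * norm (W z) powr (k * q)"
          by (simp flip: powr_add)
        also have "\<dots> \<le> L powr (p - k * q) * norm (W z) powr (k * q)"
          using k L by (intro mult_right_mono powr_mono2) auto
        finally show ?thesis .
      qed
      then show "ennreal (norm (W z) powr p) * indicator (S \<inter> A) z
        \<le> ennreal (L powr (p - k * q)) * (ennreal ((norm (W z) powr k * indicator A z) powr q) * indicator S z)"
        by (auto simp: indicator_def powr_powr intro!: ennreal_leI simp flip: ennreal_mult)
    qed
    also have "\<dots> = ennreal (L powr (p - k * q)) * (\<integral>\<^sup>+ z. ennreal ((norm (W z) powr k * indicator A z) powr q) * indicator S z \<partial>mu)"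
      by (intro nn_integral_cmult) measurable
    also have "\<dots> \<le> ennreal (L powr (p - k * q)) * ennreal (m powr (1 - q) * H' powr q)"
    proof (intro mult_left_mono nn_integral_powr_le)
      have "(\<integral>\<^sup>+ z. ennreal (norm (W z) powr k * indicator A z) * indicator S z \<partial>mu)
          \<le> (\<integral>\<^sup>+ z. ennreal (norm (W z) powr k) * indicator A z \<partial>mu)"
        by (intro nn_integral_mono) (auto simp: indicator_def)
      then show "(\<integral>\<^sup>+ z. ennreal (norm (W z) powr k * indicator A z) * indicator S z \<partial>mu) \<le> ennreal H'"
        using H' by (rule order_trans)
    qed (use q m \<open>0 < H'\<close> in auto)
    finally show ?thesis
      by (simp add: ennreal_mult)
  qed
  \<comment> \<open>\<open>X\<close> and \<open>Y\<close> are the p-th roots of the two bounds from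
    \<open>piece\<close>; their exponents come from 1 - q = q/p = 1/(p + 1).\<close>
  define X where "X = m powr (1 / (p * (p + 1))) * ((L powr (p / (p + 1)) * (M * sqrt (K \<epsilon>)) powr (1 / (p + 1))) * r powr ((n / 2 - \<epsilon>) / (p + 1)))"
  define Y where "Y = m powr (1 / (p * (p + 1))) * ((L powr ((p - 1) / (p + 1)) * M powr (2 / (p + 1))) * r powr (- (2 * \<epsilon> / (p + 1))))"
  have XY: "0 < X" "0 < Y"
    using m L M K r by (auto simp: X_def Y_def)
  have pos: "0 < p + p * p"
    using p by (simp add: add_pos_pos)
  then have e: "p / (p + p * p) = 1 / (1 + p)"
    using p by (simp add: divide_simps) (simp add: algebra_simps)
  have X: "L powr (p - 1 * q) * (m powr (1 - q) * H powr q) = X powr p"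
    using m L M K r p pos by (simp add: X_def H_def powr_mult powr_powr q_def field_simps e)
  have Y: "L powr (p - 2 * q) * (m powr (1 - q) * (r powr (- (2 * \<epsilon>)) * M^2) powr q) = Y powr p"
    using m L M K r p pos by (simp add: Y_def powr_mult powr_powr q_def field_simps e flip: powr_numeral)
  have "(\<integral>\<^sup>+ z. ennreal (norm (W z) powr p) * indicator S z \<partial>mu)
      = (\<integral>\<^sup>+ z. ennreal (norm (W z) powr p) * indicator (S \<inter> cball 0 r) z
          + ennreal (norm (W z) powr p) * indicator (S \<inter> - cball 0 r) z \<partial>mu)"
    by (intro nn_integral_cong) (auto simp: indicator_def)
  also have "\<dots> = (\<integral>\<^sup>+ z. ennreal (norm (W z) powr p) * indicator (S \<inter> cball 0 r) z \<partial>mu)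
      + (\<integral>\<^sup>+ z. ennreal (norm (W z) powr p) * indicator (S \<inter> - cball 0 r) z \<partial>mu)"
    by (intro nn_integral_add) measurable
  also have "\<dots> \<le> ennreal (X powr p) + ennreal (Y powr p)"
    using piece[of "cball 0 r" 1 H] piece[of "- cball 0 r" 2 "r powr (- (2 * \<epsilon>)) * M^2"] q near far \<open>H > 0\<close> M r
    unfolding X Y by (intro add_mono) auto
  also have "\<dots> = ennreal (X powr p + Y powr p)"
    by simp
  \<comment> \<open>Superadditivity brings the sum inside the power, so that only X + Y remains to
    be minimised over the radius.\<close>
  also have "\<dots> \<le> ennreal ((X + Y) powr p)"
    using powr_superadditive[OF XY p] by (intro ennreal_leI)
  finally show ?thesis
    by (simp add: X_def Y_def distrib_left)
qed

section \<open>Extended powers, norms and the explicit constant\<close>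

lemma enn_powr_ennreal: "0 \<le> x \<Longrightarrow> ennreal x powr\<^sub>e a = ennreal (x powr a)"
  by (simp add: enn_powr_def)

lemma enn_powr_top: "top powr\<^sub>e a = top"
  by (simp add: enn_powr_def)

lemma enn_powr_zero: "0 powr\<^sub>e a = 0"
  by (simp add: enn_powr_def)

lemma enn_powr_mono: "x \<le> y \<Longrightarrow> 0 \<le> a \<Longrightarrow> x powr\<^sub>e a \<le> y powr\<^sub>e a"
  by (cases x; cases y) (auto simp: enn_powr_ennreal enn_powr_top top_unique intro!: ennreal_leI powr_mono2)

lemma enn_powr_powr: "(x powr\<^sub>e a) powr\<^sub>e b = x powr\<^sub>e (a * b)"
  by (cases x) (auto simp: enn_powr_ennreal enn_powr_top powr_powr)

lemma Lp_norm_indicator: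
  assumes "0 < p"
  shows "Lp_norm p (\<lambda>z. indicator S z *\<^sub>R W z) powr\<^sub>e (p * (p + 1))
    = (\<integral>\<^sup>+ z. ennreal (norm (W z) powr p) * indicator S z \<partial>mu) powr\<^sub>e (p + 1)"
proof -
  have "(\<integral>\<^sup>+ z. ennreal (norm (indicator S z *\<^sub>R W z) powr p) \<partial>mu)
      = (\<integral>\<^sup>+ z. ennreal (norm (W z) powr p) * indicator S z \<partial>mu)"
    using assms by (intro nn_integral_cong) (auto simp: indicator_def)
  then show ?thesis
    using assms by (simp add: Lp_norm_def enn_powr_powr)
qed

lemma Lp_norm_2_finiteE:
  assumes "Lp_norm 2 f < \<infinity>"
  obtains F where "0 \<le> F" "Lp_norm 2 f = ennreal F" "(\<integral>\<^sup>+ t. (ennreal (norm (f t)))\<^sup>2 \<partial>mu) = ennreal (F\<^sup>2)"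
proof -
  let ?I = "\<integral>\<^sup>+ t. ennreal (norm (f t) powr 2) \<partial>mu"
  have I: "?I = (\<integral>\<^sup>+ t. (ennreal (norm (f t)))\<^sup>2 \<partial>mu)"
    by (intro nn_integral_cong) (simp add: ennreal_power)
  have "?I \<noteq> top"
    using assms by (auto simp: Lp_norm_def enn_powr_top)
  then obtain i where i: "0 \<le> i" "?I = ennreal i"
    by (cases ?I) auto
  then show ?thesis
    using that[of "sqrt i"] I by (simp add: Lp_norm_def enn_powr_ennreal powr_half_sqrt)
qed

text \<open>Both sides are positive, so it suffices to compare logarithms. There the claim becomes a
  polynomial identity in which the logarithms of the separate factors act as indeterminates.\<close>

lemma local_uncertainty_constant:
  fixes d \<epsilon> p Gm A M m :: real
  assumes "0 < d" "0 < \<epsilon>" "\<epsilon> < 2 * d" "1 \<le> p" "0 < Gm" "0 < A" "0 < M" "0 < m"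
  defines "L \<equiv> 2 powr (2 * d) * A" and "K \<equiv> 1 / (2 powr (2 * d) * Gm * (2 * d - \<epsilon>))"
  defines "a \<equiv> L powr (p / (p + 1)) * (M * sqrt K) powr (1 / (p + 1))"
    and "b \<equiv> L powr ((p - 1) / (p + 1)) * M powr (2 / (p + 1))"
    and "\<alpha> \<equiv> (2 * d - \<epsilon>) / (p + 1)" and "\<beta> \<equiv> 2 * \<epsilon> / (p + 1)"
  defines "\<theta> \<equiv> \<beta> / (\<alpha> + \<beta>)"
  shows "(m powr (1 / (p * (p + 1))) * (a powr \<theta> * b powr (1 - \<theta>) * ((\<alpha> + \<beta>) / (\<alpha> powr (1 - \<theta>) * \<beta> powr \<theta>)))) powr (p * (p + 1))
    = 2 powr (2*d * (p - 2) * (p + 1) + 4*d + 4*p*d*\<epsilon> / (2*d + \<epsilon>)) *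
        ((2*d + \<epsilon>) /
         (2 powr (\<epsilon> * (2*d + 2*p + 2) / ((2*d + \<epsilon>) * (p + 1))) *
          \<epsilon> powr (2*\<epsilon> / (2*d + \<epsilon>)) *
          Gm powr (\<epsilon> / ((2*d + \<epsilon>) * (p + 1))) *
          (2*d - \<epsilon>) powr ((2*d - \<epsilon>) / (2*d + \<epsilon>) + \<epsilon> / ((2*d + \<epsilon>) * (p + 1)))))
        powr (p * (p + 1)) * m * M powr (4*p*d / (2*d + \<epsilon>)) * A powr (p * (p - (2*d - \<epsilon>) / (2*d + \<epsilon>)))"
    (is "?lhs = ?rhs")
proof -
  \<comment> \<open>All fractional exponents are expressible through this \<open>x\<close> and
    \<open>s\<close>: \<theta> = 2x, (2d - \<epsilon>)/(2d + \<epsilon>) = 1 - 2x and 4pd/(2d +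
    \<epsilon>) = 2p(1 - x).\<close>
  define x where "x = \<epsilon> / (2 * d + \<epsilon>)"
  define s where "s = p + 1"
  have pos: "0 < 2 * d - \<epsilon>" "0 < 2 * d + \<epsilon>" "0 < p" "0 < s"
    using assms by (auto simp: s_def)
  have sum: "\<alpha> + \<beta> = (2 * d + \<epsilon>) / s"
    by (simp add: \<alpha>_def \<beta>_def s_def add_divide_distrib[symmetric])
  have \<theta>: "\<theta> = 2 * x"
    unfolding \<theta>_def sum using pos by (simp add: \<beta>_def s_def x_def)
  have exponents: "4*p*d*\<epsilon> / (2*d + \<epsilon>) = 4*p*d*x" "\<epsilon> * (2*d + 2*p + 2) / ((2*d + \<epsilon>) * (p + 1)) = x * (2*d + 2*p + 2) / s"
      "2*\<epsilon> / (2*d + \<epsilon>) = 2 * x" "\<epsilon> / ((2*d + \<epsilon>) * (p + 1)) = x / s" "(2*d - \<epsilon>) / (2*d + \<epsilon>) = 1 - 2 * x"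
      "4*p*d / (2*d + \<epsilon>) = 2 * p * (1 - x)"
    using pos by (auto simp: x_def s_def field_simps)
  have K: "0 < K" and L: "0 < L"
    using assms pos by (auto simp: K_def L_def)
  have lnK: "ln K = - (2 * d * ln 2 + ln Gm + ln (2 * d - \<epsilon>))"
    using assms(5) pos by (simp add: K_def ln_div ln_mult)
  have lnL: "ln L = 2 * d * ln 2 + ln A"
    using assms(6) by (simp add: L_def ln_mult)
  have ab: "0 < a" "0 < b" "0 < \<alpha>" "0 < \<beta>"
    using assms(2,7) K L pos by (auto simp: a_def b_def \<alpha>_def \<beta>_def s_def)
  \<comment> \<open>Multiplication by s = p + 1 clears the denominators in the exponents of
    \<open>a\<close> and \<open>b\<close>.\<close>
  have lna: "s * ln a = p * ln L + ln M + ln K / 2"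
    using assms(7) K L pos unfolding a_def s_def[symmetric] by (simp add: ln_mult ln_sqrt field_simps)
  have lnb: "s * ln b = (p - 1) * ln L + 2 * ln M"
    using assms(7) L pos unfolding b_def s_def[symmetric] by (simp add: ln_mult field_simps)
  have ln\<alpha>\<beta>: "ln \<alpha> = ln (2 * d - \<epsilon>) - ln s" "ln \<beta> = ln 2 + ln \<epsilon> - ln s" "ln (\<alpha> + \<beta>) = ln (2 * d + \<epsilon>) - ln s"
    using assms(2) pos unfolding sum unfolding \<alpha>_def \<beta>_def s_def[symmetric] by (simp_all add: ln_div ln_mult)
  have "ln ?lhs = p * s * (ln m / (p * s) + (2 * x * ln a + (1 - 2 * x) * ln b + (ln (\<alpha> + \<beta>) - ((1 - 2 * x) * ln \<alpha> + 2 * x * ln \<beta>))))"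
    unfolding \<theta> s_def[symmetric] using assms(8) ab by (simp add: ln_mult ln_div)
  also have "\<dots> = ln m + p * (2 * x * (s * ln a) + (1 - 2 * x) * (s * ln b)) + p * s * (ln (\<alpha> + \<beta>) - ((1 - 2 * x) * ln \<alpha> + 2 * x * ln \<beta>))"
    using pos by (simp add: field_simps)
  also have "\<dots> = ln m + p * (2 * x * (p * ln L + ln M + ln K / 2) + (1 - 2 * x) * ((p - 1) * ln L + 2 * ln M))
      + p * s * (ln (2 * d + \<epsilon>) - (1 - 2 * x) * ln (2 * d - \<epsilon>) - 2 * x * (ln 2 + ln \<epsilon>))"
    unfolding lna lnb ln\<alpha>\<beta> by (simp add: algebra_simps)
  finally have lhs: "ln ?lhs = \<dots>" .
  have "ln ?rhs = (2*d * (p - 2) * s + 4*d + 4*p*d*x) * ln 2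
      + p * s * (ln (2*d + \<epsilon>) - (x * (2*d + 2*p + 2) / s * ln 2 + 2 * x * ln \<epsilon> + x / s * ln Gm + (1 - 2 * x + x / s) * ln (2*d - \<epsilon>)))
      + ln m + 2 * p * (1 - x) * ln M + p * (p - (1 - 2 * x)) * ln A"
    unfolding exponents unfolding s_def[symmetric] using assms(2,5-8) pos by (simp add: ln_mult ln_div)
  also have "\<dots> = (2*d * (p - 2) * s + 4*d + 4*p*d*x) * ln 2
      + p * (s * ln (2*d + \<epsilon>) - (x * (2*d + 2*p + 2) * ln 2 + 2 * x * s * ln \<epsilon> + x * ln Gm + ((1 - 2 * x) * s + x) * ln (2*d - \<epsilon>)))
      + ln m + 2 * p * (1 - x) * ln M + p * (p - (1 - 2 * x)) * ln A"
    using pos by (simp add: field_simps)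
  also have "\<dots> = ln ?lhs"
    unfolding lhs lnK lnL s_def by (simp add: field_simps power2_eq_square)
  finally have "ln ?rhs = ln ?lhs" .
  moreover have "0 < ?lhs"
    using assms(8) ab by simp
  moreover have "0 < ?rhs"
    using assms(2,5-8) pos by simp
  ultimately show ?thesis
    by (metis ln_inj_iff)
qed

section \<open>Degenerate cases and evaluation at the optimal radius\<close>

theorem corollary15:
  fixes \<epsilon> p d :: real
  defines "d \<equiv> real CARD('d::finite)"
  assumes "0 < \<epsilon>" "\<epsilon> < 2 * d" and "1 \<le> p"
  shows "\<exists>N::real. 0 \<le> N \<and>
    N = 2 powr (2*d * (p - 2) * (p + 1) + 4*d + 4*p*d*\<epsilon> / (2*d + \<epsilon>)) *
        ((2*d + \<epsilon>) /
         (2 powr (\<epsilon> * (2*d + 2*p + 2) / ((2*d + \<epsilon>) * (p + 1))) *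
          \<epsilon> powr (2*\<epsilon> / (2*d + \<epsilon>)) *
          Gamma (2*d) powr (\<epsilon> / ((2*d + \<epsilon>) * (p + 1))) *
          (2*d - \<epsilon>) powr ((2*d - \<epsilon>) / (2*d + \<epsilon>) + \<epsilon> / ((2*d + \<epsilon>) * (p + 1)))))
        powr (p * (p + 1)) \<and>
    (\<forall>(g :: 'd R2d \<Rightarrow> quat) (f :: 'd R2d \<Rightarrow> quat) (\<Sigma> :: ('d R2d \<times> 'd R2d) set).
       quat_window g \<longrightarrow> f \<in> L2 \<longrightarrow> \<Sigma> \<in> sets lebesgue \<longrightarrow> emeasure mu \<Sigma> < \<infinity> \<longrightarrow>
       Lp_norm p (\<lambda>z. indicator \<Sigma> z *\<^sub>R wigner f g z) powr\<^sub>e (p * (p + 1))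
       \<le> ennreal N * emeasure mu \<Sigma> *
         Lp_norm 2 (\<lambda>z. norm z powr \<epsilon> *\<^sub>R wigner f g z) powr\<^sub>e (4*p*d / (2*d + \<epsilon>)) *
         (Lp_norm 2 f * Lp_norm 2 g) powr\<^sub>e (p * (p - (2*d - \<epsilon>) / (2*d + \<epsilon>))))"
proof -
  define N where "N = 2 powr (2*d * (p - 2) * (p + 1) + 4*d + 4*p*d*\<epsilon> / (2*d + \<epsilon>)) *
        ((2*d + \<epsilon>) /
         (2 powr (\<epsilon> * (2*d + 2*p + 2) / ((2*d + \<epsilon>) * (p + 1))) *
          \<epsilon> powr (2*\<epsilon> / (2*d + \<epsilon>)) *
          Gamma (2*d) powr (\<epsilon> / ((2*d + \<epsilon>) * (p + 1))) *
          (2*d - \<epsilon>) powr ((2*d - \<epsilon>) / (2*d + \<epsilon>) + \<epsilon> / ((2*d + \<epsilon>) * (p + 1)))))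
        powr (p * (p + 1))"
  have d: "0 < d" and Gm: "0 < Gamma (2 * d)"
    by (simp_all add: d_def Gamma_real_pos)
  have N: "0 < N"
    unfolding N_def using assms(2,3) Gm[THEN less_imp_neq, symmetric] d by (intro mult_pos_pos powr_gt_zero[THEN iffD2] divide_pos_pos) auto
  define k1 where "k1 = 4*p*d / (2*d + \<epsilon>)"
  define k2 where "k2 = p * (p - (2*d - \<epsilon>) / (2*d + \<epsilon>))"
  have "(2*d - \<epsilon>) / (2*d + \<epsilon>) < 1"
    using assms(2,3) d by (simp add: divide_simps)
  then have k2: "0 < k2"
    using assms(4) by (simp add: k2_def)
  have "Lp_norm p (\<lambda>z. indicator \<Sigma> z *\<^sub>R wigner f g z) powr\<^sub>e (p * (p + 1))
       \<le> ennreal N * emeasure mu \<Sigma> * Lp_norm 2 (\<lambda>z. norm z powr \<epsilon> *\<^sub>R wigner f g z) powr\<^sub>e k1 *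
         (Lp_norm 2 f * Lp_norm 2 g) powr\<^sub>e k2"
    if f: "f \<in> L2" and g: "g \<in> L2" and \<Sigma>: "\<Sigma> \<in> sets lebesgue" "emeasure mu \<Sigma> < \<infinity>"
    for f g :: "'d R2d \<Rightarrow> quat" and \<Sigma>
  proof -
    let ?W = "wigner f g"
    let ?I = "\<integral>\<^sup>+ z. ennreal (norm (?W z) powr p) * indicator \<Sigma> z \<partial>mu"
    have fm: "f \<in> borel_measurable lebesgue" and gm: "g \<in> borel_measurable lebesgue"
      using f g by (auto simp: L2_def)
    have W: "?W \<in> borel_measurable borel"
      by (rule borel_measurable_wigner[OF fm gm])
    have W_leb [measurable]: "?W \<in> borel_measurable lebesgue"
      by (intro measurable_completion) (simp only: W measurable_lborel2)
    have id_leb [measurable]: "(\<lambda>z::'d R2d \<times> 'd R2d. z) \<in> borel_measurable lebesgue"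
      by (intro measurable_completion) simp
    obtain F where F: "0 \<le> F" "Lp_norm 2 f = ennreal F" "(\<integral>\<^sup>+ t. (ennreal (norm (f t)))\<^sup>2 \<partial>mu) = ennreal (F\<^sup>2)"
      using f Lp_norm_2_finiteE[of f] unfolding L2_def by blast
    obtain G where G: "0 \<le> G" "Lp_norm 2 g = ennreal G" "(\<integral>\<^sup>+ t. (ennreal (norm (g t)))\<^sup>2 \<partial>mu) = ennreal (G\<^sup>2)"
      using g Lp_norm_2_finiteE[of g] unfolding L2_def by blast
    have sup: "norm (?W z) \<le> 2 powr (2 * d) * (F * G)" for z
      using norm_wigner_le[OF fm gm F(3,1) G(3,1), of z] by (simp add: d_def powr_realpow[symmetric] mult.assoc)
    \<comment> \<open>This disposes of every case with a vanishing factor, namely a null set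
      \<Sigma>, F G = 0 and M = 0: the left-hand side is 0, whatever the other factors are.\<close>
    have trivial: ?thesis if "AE z in mu. ?W z = 0 \<or> z \<notin> \<Sigma>"
    proof -
      have "AE z in mu. ennreal (norm (?W z) powr p) * indicator \<Sigma> z = 0"
        using that by eventually_elim (auto simp: indicator_def)
      then have "?I = (\<integral>\<^sup>+ z. 0 \<partial>(mu :: ('d R2d \<times> 'd R2d) measure))"
        by (rule nn_integral_cong_AE)
      then show ?thesis
        using assms(4) by (simp add: Lp_norm_indicator enn_powr_zero)
    qed
    show ?thesis
    proof (cases "emeasure mu \<Sigma> = 0 \<or> F * G = 0")
      case True
      have "AE z in mu. ?W z = 0 \<or> z \<notin> \<Sigma>"
      proof (cases "F * G = 0")
        case True
        then have "?W z = 0" for z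
          using sup[of z] unfolding True by simp
        then show ?thesis
          by simp
      next
        case False
        then have "\<Sigma> \<in> null_sets mu"
          using True \<Sigma>(1) by (simp add: null_sets_def)
        then show ?thesis
          by (rule AE_not_in[THEN AE_mp]) simp
      qed
      then show ?thesis
        by (rule trivial)
    next
      case nonzero: False
      then have A: "0 < F * G"
        using F(1) G(1) by (simp add: less_le)
      obtain m where m: "0 < m" "emeasure mu \<Sigma> = ennreal m"
        using \<Sigma>(2) nonzero by (cases "emeasure mu \<Sigma>") (auto simp: less_le)
      show ?thesis
      proof (cases "Lp_norm 2 (\<lambda>z. norm z powr \<epsilon> *\<^sub>R ?W z) = top")
        case True
        \<comment> \<open>All other factors on the right are positive by now, so an infinite
          weighted norm makes the right-hand side infinite.\<close>
        then show ?thesis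
          using N A nonzero m F(1,2) G(1,2) by (simp add: enn_powr_top enn_powr_ennreal ennreal_mult_top ennreal_top_mult flip: ennreal_mult)
      next
        case False
        then have "Lp_norm 2 (\<lambda>z. norm z powr \<epsilon> *\<^sub>R ?W z) < \<infinity>"
          by (simp add: less_top)
        then obtain M where M: "0 \<le> M" "Lp_norm 2 (\<lambda>z. norm z powr \<epsilon> *\<^sub>R ?W z) = ennreal M"
          "(\<integral>\<^sup>+ z. (ennreal (norm (norm z powr \<epsilon> *\<^sub>R ?W z)))\<^sup>2 \<partial>mu) = ennreal (M\<^sup>2)"
          by (rule Lp_norm_2_finiteE)
        show ?thesis
        proof (cases "M = 0")
          case True
          have "AE z in mu. (ennreal (norm (norm z powr \<epsilon> *\<^sub>R ?W z)))\<^sup>2 = 0"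
          proof (rule nn_integral_0_iff_AE[THEN iffD1])
            show "(\<integral>\<^sup>+ z. (ennreal (norm (norm z powr \<epsilon> *\<^sub>R ?W z)))\<^sup>2 \<partial>mu) = 0"
              unfolding M(3) True by simp
          qed measurable
          \<comment> \<open>The weight |z|^\<epsilon> vanishes only at the origin, so elsewhere the
            transform itself must vanish almost everywhere.\<close>
          moreover have "AE z in mu. z \<noteq> (0 :: 'd R2d \<times> 'd R2d)"
            by (simp add: AE_mu AE_lborel_singleton)
          ultimately have "AE z in mu. ?W z = 0 \<or> z \<notin> \<Sigma>"
            by eventually_elim simp
          then show ?thesis
            by (rule trivial)
        next
          case False
          then have Mpos: "0 < M"
            using M(1) by simp
          define L where "L = 2 powr (2 * d) * (F * G)"
          define K where "K = 1 / (2 powr (2 * d) * Gamma (2 * d) * (2 * d - \<epsilon>))"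
          define a where "a = L powr (p / (p + 1)) * (M * sqrt K) powr (1 / (p + 1))"
          define b where "b = L powr ((p - 1) / (p + 1)) * M powr (2 / (p + 1))"
          have L: "0 < L" and K: "0 < K"
            using A Gm assms(3) by (simp_all add: L_def K_def)
          have n: "real DIM('d R2d \<times> 'd R2d) = 4 * d"
            by (simp add: d_def)
          \<comment> \<open>In dimension 4d the unit ball has volume \<pi>^(2d)/\<Gamma>(2d + 1),
            and \<Gamma>(2d + 1) = 2d \<Gamma>(2d); the powers of \<pi> cancel against the
            normalisation of \<open>mu\<close>.\<close>
          have K_eq: "unit_ball_vol (4 * d) * (4 * d) / ((4 * d - 2 * \<epsilon>) * (2 * pi) powr (4 * d / 2)) = K"
          proof -
            have "Gamma (2 * d + 1) = 2 * d * Gamma (2 * d)"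
              using d by (intro Gamma_plus1) (auto elim!: nonpos_Ints_cases)
            then have vol: "unit_ball_vol (4 * d) = pi powr (2 * d) / (2 * d * Gamma (2 * d))"
              by (simp add: unit_ball_vol_def)
            have cancel: "P / (2 * d * c) * (4 * d) / (2 * e * (Q * P)) = 1 / (Q * c * e)"
              if "0 < P" "0 < c" "0 < e" "0 < Q" for P Q c e :: real
              using that d by (simp add: field_simps)
            have "4 * d - 2 * \<epsilon> = 2 * (2 * d - \<epsilon>)" "(2 * pi) powr (4 * d / 2) = 2 powr (2 * d) * pi powr (2 * d)"
              by (simp_all add: powr_mult)
            then show ?thesis
              unfolding vol K_def by (simp only:) (rule cancel, use Gm assms(3) in auto)
          qed
          \<comment> \<open>The nested fractions are the exponent \<theta> = \<beta>/(\<alpha> +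
            \<beta>) of \<open>powr_balance\<close> for \<alpha> = (2d - \<epsilon>)/(p + 1) and
            \<beta> = 2\<epsilon>/(p + 1), left unsimplified to match
            \<open>local_uncertainty_constant\<close>.\<close>
          obtain r where r: "0 < r"
            "a * r powr ((2 * d - \<epsilon>) / (p + 1)) + b * r powr (- (2 * \<epsilon> / (p + 1)))
              = a powr (2 * \<epsilon> / (p + 1) / ((2 * d - \<epsilon>) / (p + 1) + 2 * \<epsilon> / (p + 1)))
                * b powr (1 - 2 * \<epsilon> / (p + 1) / ((2 * d - \<epsilon>) / (p + 1) + 2 * \<epsilon> / (p + 1)))
                * (((2 * d - \<epsilon>) / (p + 1) + 2 * \<epsilon> / (p + 1))
                  / (((2 * d - \<epsilon>) / (p + 1)) powr (1 - 2 * \<epsilon> / (p + 1) / ((2 * d - \<epsilon>) / (p + 1) + 2 * \<epsilon> / (p + 1)))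
                    * (2 * \<epsilon> / (p + 1)) powr (2 * \<epsilon> / (p + 1) / ((2 * d - \<epsilon>) / (p + 1) + 2 * \<epsilon> / (p + 1)))))"
            by (rule powr_balance[of a b "(2 * d - \<epsilon>) / (p + 1)" "2 * \<epsilon> / (p + 1)"])
               (use L K Mpos assms(2-4) in \<open>auto simp: a_def b_def\<close>)
          define T where "T = m powr (1 / (p * (p + 1))) * (a * r powr ((2 * d - \<epsilon>) / (p + 1)) + b * r powr (- (2 * \<epsilon> / (p + 1))))"
          have weighted: "(\<integral>\<^sup>+ z. (ennreal (norm z powr \<epsilon> * norm (?W z)))\<^sup>2 \<partial>mu) \<le> ennreal (M\<^sup>2)"
            using M(3) by simp
          have "4 * d / 2 - \<epsilon> = 2 * d - \<epsilon>"
            by simp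
          \<comment> \<open>With n = 4d the condition 2\<epsilon> < n becomes 2\<epsilon> < 4d,
            which is \<epsilon> < 2d, and n/2 - \<epsilon> is 2d - \<epsilon>.\<close>
          then have "?I \<le> ennreal (T powr p)"
            using nn_integral_local_uncertainty[OF W \<Sigma>(1) assms(2) _ assms(4) L _ Mpos weighted m(1) _ r(1)] sup m(2) assms(3)
            unfolding n K_eq by (simp add: T_def a_def b_def L_def)
          then have "Lp_norm p (\<lambda>z. indicator \<Sigma> z *\<^sub>R ?W z) powr\<^sub>e (p * (p + 1)) \<le> ennreal (T powr p) powr\<^sub>e (p + 1)"
            using assms(4) by (subst Lp_norm_indicator) (auto intro: enn_powr_mono)
          also have "\<dots> = ennreal (T powr (p * (p + 1)))"
            by (simp add: enn_powr_ennreal powr_powr)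
          also have "T powr (p * (p + 1)) = N * m * M powr k1 * (F * G) powr k2"
            unfolding T_def r(2) unfolding N_def k1_def k2_def a_def b_def L_def K_def
            by (rule local_uncertainty_constant[OF d assms(2-4) Gm A Mpos m(1)])
          also have "ennreal \<dots> = ennreal N * emeasure mu \<Sigma> * Lp_norm 2 (\<lambda>z. norm z powr \<epsilon> *\<^sub>R ?W z) powr\<^sub>e k1 *
              (Lp_norm 2 f * Lp_norm 2 g) powr\<^sub>e k2"
            using N m F(1,2) G(1,2) M(1,2) by (simp add: enn_powr_ennreal flip: ennreal_mult)
          finally show ?thesis .
        qed
      qed
    qed
  qed
  then show ?thesis
    using N unfolding N_def k1_def k2_def quat_window_def by (intro exI conjI allI impI refl) auto
qed

end
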